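(* For $\lambda,\mu,\xi>0$ and $d,N\in\mathbb N^+$, the asymptotic probability generating function $F(z)=\lim_{t\to+\infty}E[z^{\mathcal N(t)}]$ is given, for $z\in(0,1]$, by $$\begin{aligned}F(z)={}&-\frac{N\mu(1-z)(\lambda z+\mu)^N}{(\lambda+\mu)^{2N}z^N}\,g(\lambda,\mu,\xi,N)\sum_{j=0}^{N-1}\binom{N-1}{j}[(\lambda+\mu)z]^{N-j-1}[\mu(1-z)]^j\\ &\quad\times\frac{\Gamma(j+1)\Gamma\left(\frac{\xi}{\lambda+\mu}+1\right)}{\Gamma\left(j+\frac{\xi}{\lambda+\mu}+2\right)}\,{}_2F_1\left(\frac{\xi}{\lambda+\mu}+1,-N,\frac{\xi}{\lambda+\mu}+j+2;-\frac{\lambda(1-z)}{\lambda z+\mu}\right)\\ &+\frac{(\lambda z+\mu)^N}{(\lambda+\mu)^{2N}z^N}\sum_{j=0}^N\binom Nj[(\lambda+\mu)z]^{N-j}[\mu(1-z)]^j\\ &\quad\times\frac{\Gamma(j+1)\Gamma\left(\frac{\xi}{\lambda+\mu}+1\right)}{\Gamma\left(j+\frac{\xi}{\lambda+\mu}+1\right)}\,{}_2F_1\left(\frac{\xi}{\lambda+\mu},-N,\frac{\xi}{\lambda+\mu}+j+1;-\frac{\lambda(1-z)}{\lambda z+\mu}\right),\end{aligned}$$ where $$g(\lambda,\mu,\xi,N)=\frac{{}_2F_1\left(\frac{\xi}{\lambda+\mu},-N,\frac{\xi}{\lambda+\mu}+N+1;-\frac\lambda\mu\right)}{{}_2F_1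\left(\frac{\xi}{\lambda+\mu}+1,-N,\frac{\xi}{\lambda+\mu}+N+1;-\frac\lambda\mu\right)}.$$
   Context: Let $N,d$ be positive integers, $D=\{1,\dots,d\}$, $\lambda,\mu,\xi>0$, and let $\mathbf C=(c_{l,j})_{l,j\in D}$ be an irreducible stochastic matrix. The process $\mathbf X_t=(\mathcal N(t),J(t))$, $t\ge 0$, is the continuous-time Markov chain on $\{0,1,\dots,N\}\times D$ (first coordinate: level; second coordinate: phase) started at $(0,l_0)$ for some $l_0\in D$, with the following transition rates: from $(0,l)$ to $(1,j)$ at rate $c_{l,j}\lambda N$ for $l,j\in D$; from $(k,j)$ to $(k+1,j)$ at rate $\lambda(N-k)$ for $1\le k\le N-1$; from $(k,j)$ to $(k-1,j)$ at rate $\mu(N+k)$ for $1\le k\le N$; and, in addition, from $(k,j)$ to $(0,j)$ at rate $\xi$ for $1\le k\le N$ (catastrophe; for $k=1$ the total rate from $(1,j)$ to $(0,j)$ is $\mu(N+1)+\xi$). No other transitions occur. ${}_2F_1(a,b,c;x)=\sum_{i\ge0}\frac{(a)_i(b)_i}{(c)_i\,i!}x^i$ is the Gauss hypergeometric function (a terminating sum when $b=-N$), with $(x)_i$ the rising factorial. *)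

theory Defs
  imports "HOL-Probability.Probability"
begin

definition stochastic_on :: "'s set \<Rightarrow> ('s \<Rightarrow> 's \<Rightarrow> real) \<Rightarrow> bool" where
  "stochastic_on S P \<longleftrightarrow> (\<forall>i\<in>S. \<forall>j\<in>S. 0 \<le> P i j) \<and> (\<forall>i\<in>S. (\<Sum>j\<in>S. P i j) = 1)"

text \<open>A nonnegative matrix is irreducible if its directed graph (an edge for every positive
  entry) is strongly connected.\<close>

definition irreducible_on :: "'s set \<Rightarrow> ('s \<Rightarrow> 's \<Rightarrow> real) \<Rightarrow> bool" where
  "irreducible_on S P \<longleftrightarrow>
     (\<forall>i\<in>S. \<forall>j\<in>S. (i, j) \<in> {(a, b). a \<in> S \<and> b \<in> S \<and> 0 < P a b}\<^sup>*)"

text \<open>Transition functions \<open>p t i j\<close> (time, from, to) on a finite state space \<open>S\<close>;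
  the last condition is the Chapman--Kolmogorov equation.\<close>

definition transition_function :: "'s set \<Rightarrow> (real \<Rightarrow> 's \<Rightarrow> 's \<Rightarrow> real) \<Rightarrow> bool" where
  "transition_function S p \<longleftrightarrow>
     (\<forall>t\<ge>0. stochastic_on S (p t)) \<and>
     (\<forall>i\<in>S. \<forall>j\<in>S. p 0 i j = (if i = j then 1 else 0)) \<and>
     (\<forall>s\<ge>0. \<forall>t\<ge>0. \<forall>i\<in>S. \<forall>j\<in>S. p (s + t) i j = (\<Sum>k\<in>S. p s i k * p t k j))"

text \<open>\<open>q i j\<close> is the rate of the transition from \<open>i\<close> to \<open>j\<close>, for \<open>i \<noteq> j\<close>; the diagonal of \<open>q\<close>
  is irrelevant. On a finite state space the off-diagonal rates determine the diagonal
  derivatives at \<open>0\<close>, and hence the transition function, because rows sum to \<open>1\<close>.\<close>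

definition has_transition_rates ::
    "'s set \<Rightarrow> (real \<Rightarrow> 's \<Rightarrow> 's \<Rightarrow> real) \<Rightarrow> ('s \<Rightarrow> 's \<Rightarrow> real) \<Rightarrow> bool" where
  "has_transition_rates S p q \<longleftrightarrow>
     (\<forall>i\<in>S. \<forall>j\<in>S. i \<noteq> j \<longrightarrow> ((\<lambda>h. p h i j / h) \<longlongrightarrow> q i j) (at_right 0))"

text \<open>Time-homogeneous continuous-time Markov chains with finite state space \<open>S\<close> and transition
  rates \<open>q\<close>. No regularity of the sample paths is imposed.\<close>

definition ct_markov_chain ::
    "'w measure \<Rightarrow> (real \<Rightarrow> 'w \<Rightarrow> 's) \<Rightarrow> 's set \<Rightarrow> ('s \<Rightarrow> 's \<Rightarrow> real) \<Rightarrow> bool" where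
  "ct_markov_chain M X S q \<longleftrightarrow>
     prob_space M \<and> finite S \<and>
     (\<forall>t\<ge>0. X t \<in> measurable M (count_space S)) \<and>
     (\<exists>p. transition_function S p \<and> has_transition_rates S p q \<and>
        (\<forall>(n::nat) (s :: nat \<Rightarrow> real) t (x :: nat \<Rightarrow> 's) j.
           0 \<le> s 0 \<and> (\<forall>i<n. s i < s (Suc i)) \<and> s n < t \<and> (\<forall>i\<le>n. x i \<in> S) \<and> j \<in> S \<and>
           \<P>(\<omega> in M. \<forall>i\<le>n. X (s i) \<omega> = x i) > 0 \<longrightarrow>
           \<P>(\<omega> in M. X t \<omega> = j \<bar> \<forall>i\<le>n. X (s i) \<omega> = x i) = p (t - s n) (x n) j))"

text \<open>States are pairs (level, phase). The contributions are added up, so that the two kinds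
  of transition from level \<open>1\<close> to level \<open>0\<close> have total rate \<open>\<mu> (N + 1) + \<xi>\<close>.\<close>

definition catastrophe_rates ::
    "nat \<Rightarrow> real \<Rightarrow> real \<Rightarrow> real \<Rightarrow> (nat \<Rightarrow> nat \<Rightarrow> real) \<Rightarrow> nat \<times> nat \<Rightarrow> nat \<times> nat \<Rightarrow> real" where
  "catastrophe_rates N lam \<mu> \<xi> c = (\<lambda>(k, l) (k', j).
       (if k = 0 \<and> k' = 1 then c l j * lam * real N else 0)
     + (if 1 \<le> k \<and> k < N \<and> k' = k + 1 \<and> j = l then lam * (real N - real k) else 0)
     + (if 1 \<le> k \<and> k \<le> N \<and> k' = k - 1 \<and> j = l then \<mu> * (real N + real k) else 0)
     + (if 1 \<le> k \<and> k \<le> N \<and> k' = 0 \<and> j = l then \<xi> else 0))"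

definition hyp2F1 :: "real \<Rightarrow> real \<Rightarrow> real \<Rightarrow> real \<Rightarrow> real" where
  "hyp2F1 a b c x =
     (\<Sum>i. pochhammer a i * pochhammer b i / (pochhammer c i * fact i) * x ^ i)"

definition g_ratio :: "real \<Rightarrow> real \<Rightarrow> real \<Rightarrow> nat \<Rightarrow> real" where
  "g_ratio lam \<mu> \<xi> N =
     hyp2F1 (\<xi> / (lam + \<mu>)) (- real N) (\<xi> / (lam + \<mu>) + real N + 1) (- (lam / \<mu>)) /
     hyp2F1 (\<xi> / (lam + \<mu>) + 1) (- real N) (\<xi> / (lam + \<mu>) + real N + 1) (- (lam / \<mu>))"

end

theory Submission
  imports Defs "HOL-Computational_Algebra.Polynomial"
begin

text \<open>The phases do not influence the level rates, so the level process is itself Markov,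
  with a generator \<open>G\<close> for which \<open>E[\<phi>(N\<^sub>t)]' = E[(G \<phi>)(N\<^sub>t)]\<close>. On signed measures of total mass \<open>0\<close> the catastrophes only
  contribute the factor \<open>- \<xi>\<close>, and the remaining birth-death chain is reversible, so a
  weighted \<open>L\<^sup>2\<close> norm of the time derivative of the level distribution decays exponentially.
  Hence \<open>E[(G \<phi>)(N\<^sub>t)] \<longlongrightarrow> 0\<close> for every \<open>\<phi>\<close>, and neither the existence of a limit
  nor a stationary distribution is needed beforehand.

  With \<open>r = (1 - z) / (lam * z + \<mu>)\<close>, the number \<open>z ^ k\<close> is, up to a factor independent of \<open>k\<close>,
  the value at \<open>y = 1\<close> of \<open>b\<^sub>k(y) = (1 - \<mu> r y) ^ (N + k) * (1 + lam r y) ^ (N - k)\<close>. Since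
  \<open>(lam + \<mu>) y b\<^sub>k'\<close> is a difference of neighbouring \<open>b\<^sub>j\<close>'s with the birth and death rates as
  coefficients, integrating by parts in \<open>\<beta>\<^sub>k = \<integral> y powr (a - 1) * b\<^sub>k(y) dy\<close>, where
  \<open>a = \<xi> / (lam + \<mu>)\<close>, expresses \<open>b\<^sub>k(1)\<close> as \<open>a \<beta>\<^sub>0 - (G \<beta>)\<^sub>k / (lam + \<mu>)\<close> plus a boundary term at
  \<open>k = 0\<close>. Averaging over the level distribution gives the limit of the generating function in
  terms of the limiting probability of level \<open>0\<close>, which in turn is read off at \<open>z = 0\<close>. Euler's
  integral turns the moments into hypergeometric functions.\<close>

subsection \<open>Moments of polynomials and terminating hypergeometric functions\<close>

text \<open>For \<open>a > 0\<close> this is the integral of \<open>y powr (a - 1) * poly p y\<close> over the unit interval.\<close>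

definition poly_moment :: "real \<Rightarrow> real poly \<Rightarrow> real" where
  "poly_moment a p = (\<Sum>i\<le>degree p. coeff p i / (a + real i))"

lemma poly_moment_eq_sum:
  assumes "degree p \<le> n"
  shows "poly_moment a p = (\<Sum>i\<le>n. coeff p i / (a + real i))"
  unfolding poly_moment_def
  using assms by (intro sum.mono_neutral_left) (auto simp: coeff_eq_0)

lemma poly_moment_0 [simp]: "poly_moment a 0 = 0"
  by (simp add: poly_moment_def)

lemma poly_moment_add: "poly_moment a (p + q) = poly_moment a p + poly_moment a q"
  using degree_add_le_max[of p q]
  by (simp add: poly_moment_eq_sum[where n = "max (degree p) (degree q)"]
      sum.distrib add_divide_distrib)

lemma poly_moment_smult: "poly_moment a (smult k p) = k * poly_moment a p"
  using degree_smult_le[of k p]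
  by (simp add: poly_moment_eq_sum[where n = "degree p"] sum_distrib_left)

lemma poly_moment_diff: "poly_moment a (p - q) = poly_moment a p - poly_moment a q"
  using poly_moment_add[of a p "smult (-1) q"] poly_moment_smult[of a "-1" q] by simp

lemma poly_moment_sum: "poly_moment a (\<Sum>j\<in>S. p j) = (\<Sum>j\<in>S. poly_moment a (p j))"
  by (induction S rule: infinite_finite_induct) (auto simp: poly_moment_add)

text \<open>An extra factor \<open>y\<close> of the polynomial is absorbed into the weight
  \<open>y powr (a - 1)\<close>.\<close>

lemma poly_moment_pCons_0: "poly_moment a (pCons 0 p) = poly_moment (a + 1) p"
proof -
  have "poly_moment a (pCons 0 p) = (\<Sum>i\<le>Suc (degree p). coeff (pCons 0 p) i / (a + real i))"
    by (rule poly_moment_eq_sum) (rule degree_pCons_le)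
  also have "\<dots> = poly_moment (a + 1) p"
    by (subst sum.atMost_Suc_shift) (simp add: poly_moment_def algebra_simps)
  finally show ?thesis .
qed

lemma poly_moment_monom_mult: "poly_moment a (monom 1 n * p) = poly_moment (a + real n) p"
proof (induction n arbitrary: a)
  case (Suc n)
  have "monom 1 (Suc n) * p = pCons 0 (monom 1 n * p)"
    by (simp add: monom_Suc)
  then show ?case
    using Suc[of "a + 1"] by (simp add: poly_moment_pCons_0 algebra_simps)
qed (simp flip: one_pCons)

text \<open>Integration by parts, with no boundary term at \<open>y = 0\<close> because
  \<open>a > 0\<close>. On coefficients it is the identity
  \<open>i / (a + i) = 1 - a / (a + i)\<close>.\<close>

lemma poly_moment_pderiv:
  assumes "a > 0"
  shows "poly_moment a (pCons 0 (pderiv p)) = poly p 1 - a * poly_moment a p"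
proof -
  have "degree (pCons 0 (pderiv p)) \<le> Suc (degree p)"
    by (intro order.trans[OF degree_pCons_le]) (simp add: degree_pderiv)
  then have "poly_moment a (pCons 0 (pderiv p)) =
      (\<Sum>i\<le>Suc (degree p). coeff (pCons 0 (pderiv p)) i / (a + real i))"
    by (rule poly_moment_eq_sum)
  also have "\<dots> = (\<Sum>i\<le>Suc (degree p). coeff p i - a * (coeff p i / (a + real i)))"
  proof (rule sum.cong)
    fix i
    have "coeff (pCons 0 (pderiv p)) i = real i * coeff p i"
      by (cases i) (auto simp: coeff_pderiv)
    moreover have "a + real i \<noteq> 0"
      using assms by (simp add: add_pos_nonneg less_imp_neq[symmetric])
    ultimately show "coeff (pCons 0 (pderiv p)) i / (a + real i)
        = coeff p i - a * (coeff p i / (a + real i))"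
      by (simp add: field_simps)
  qed simp
  also have "\<dots> = poly p 1 - a * poly_moment a p"
    by (simp add: sum_subtractf sum_distrib_left poly_altdef poly_moment_def coeff_eq_0)
  finally show ?thesis .
qed

lemma not_nonpos_Ints_of_pos: "a \<notin> \<int>\<^sub>\<le>\<^sub>0" if "a > 0" for a :: real
  using that nonpos_Ints_nonpos[of a] by force

lemma Gamma_plus1_pos: "Gamma (a + 1) = a * Gamma a" if "a > 0" for a :: real
  using that by (intro Gamma_plus1 not_nonpos_Ints_of_pos)

lemma Gamma_nonzero_pos: "Gamma a \<noteq> 0" if "a > 0" for a :: real
  using Gamma_real_pos[OF that] by simp

text \<open>This is the Beta integral \<open>B(a, j + 1)\<close>. The induction splits
  \<open>(1 - y) ^ Suc j\<close> as \<open>(1 - y) ^ j - y * (1 - y) ^ j\<close>, where the second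
  term is a moment with parameter \<open>a + 1\<close>.\<close>

lemma poly_moment_one_minus_power:
  assumes "a > 0"
  shows "poly_moment a ([:1, -1:] ^ j) = Gamma (real j + 1) * Gamma a / Gamma (a + real j + 1)"
  using assms
proof (induction j arbitrary: a)
  case 0
  then show ?case
    by (simp add: poly_moment_def Gamma_plus1_pos Gamma_nonzero_pos)
next
  case (Suc j)
  have "[:1, -1:] ^ Suc j = [:1, -1:] ^ j - pCons 0 ([:1, -1:] ^ j :: real poly)"
    by simp
  then have "poly_moment a ([:1, -1:] ^ Suc j)
      = poly_moment a ([:1, -1:] ^ j) - poly_moment (a + 1) ([:1, -1:] ^ j)"
    by (simp only: poly_moment_diff poly_moment_pCons_0)
  also have "\<dots> = Gamma (real j + 1) * Gamma a / Gamma (a + real j + 1)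
      - Gamma (real j + 1) * (a * Gamma a) / ((a + real j + 1) * Gamma (a + real j + 1))"
    using Suc.IH[of a] Suc.IH[of "a + 1"] Suc.prems Gamma_plus1_pos[of a]
      Gamma_plus1_pos[of "a + real j + 1"]
    by (simp add: add_ac)
  also have "\<dots> = ((real j + 1) * Gamma (real j + 1)) * Gamma a
      / ((a + real j + 1) * Gamma (a + real j + 1))"
  proof -
    have "a + real j + 1 \<noteq> 0" "Gamma (a + real j + 1) \<noteq> 0"
      using Suc.prems Gamma_nonzero_pos[of "a + real j + 1"] by simp_all
    then show ?thesis
      by (simp add: divide_simps) (simp add: algebra_simps)
  qed
  also have "\<dots> = Gamma (real (Suc j) + 1) * Gamma a / Gamma (a + real (Suc j) + 1)"
    using Suc.prems Gamma_plus1_pos[of "a + real j + 1"] Gamma_plus1_pos[of "real j + 1"]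
    by (simp add: add_ac)
  finally show ?case .
qed

text \<open>The series terminates since \<open>pochhammer (- n) i\<close> equals
  \<open>(-1) ^ i * fact i * (n choose i)\<close>, which is zero for \<open>i > n\<close>.\<close>

lemma hyp2F1_neg_nat:
  "hyp2F1 a (- real n) c x =
     (\<Sum>i\<le>n. real (n choose i) * (- x) ^ i * (pochhammer a i / pochhammer c i))"
proof -
  have *: "pochhammer (- real n) i = (-1) ^ i * real (n choose i) * fact i" for i
    using binomial_gbinomial[of n i, where ?'a = real] gbinomial_pochhammer[of "real n" i]
    by simp
  have "hyp2F1 a (- real n) c x = (\<Sum>i\<le>n. pochhammer a i * pochhammer (- real n) i
      / (pochhammer c i * fact i) * x ^ i)"
    unfolding hyp2F1_def by (rule suminf_finite) (auto simp: * binomial_eq_0)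
  also have "\<dots> = (\<Sum>i\<le>n. real (n choose i) * (- x) ^ i * (pochhammer a i / pochhammer c i))"
    by (intro sum.cong refl) (simp add: * power_minus[of x])
  finally show ?thesis .
qed

text \<open>All terms are nonnegative and the one at \<open>i = 0\<close> is \<open>1\<close>. This
  keeps the denominator of \<open>g_ratio\<close> away from zero.\<close>

lemma hyp2F1_neg_nat_pos:
  assumes "a > 0" "c > 0" "x \<le> 0"
  shows "hyp2F1 a (- real n) c x > 0"
proof -
  have "0 \<le> real (n choose i) * (- x) ^ i * (pochhammer a i / pochhammer c i)" for i
    using assms pochhammer_pos[of a i] pochhammer_pos[of c i] by simp
  then show ?thesis
    unfolding hyp2F1_neg_nat
    by (intro sum_pos2[where i = 0]) auto
qed

text \<open>Euler's integral for a terminating series: \<open>(1 - x * y) ^ n\<close> is expanded by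
  the binomial theorem, each power of \<open>y\<close> shifts \<open>a\<close>, and the resulting
  Beta integrals differ from the one at \<open>i = 0\<close> by a quotient of Pochhammer
  symbols.\<close>

lemma poly_moment_Euler:
  assumes "a > 0"
  shows "poly_moment a ([:1, -1:] ^ j * [:1, - x:] ^ n) =
    Gamma (real j + 1) * Gamma a / Gamma (a + real j + 1) * hyp2F1 a (- real n) (a + real j + 1) x"
proof -
  have "[:1, - x:] = 1 + monom (- x) 1"
    by (simp add: monom_altdef one_pCons)
  then have "[:1, - x:] ^ n = (\<Sum>i\<le>n. smult (real (n choose i) * (- x) ^ i) (monom 1 i))"
    by (subst (asm) add.commute)
      (simp add: binomial_ring monom_power of_nat_poly smult_monom)
  then have "poly_moment a ([:1, -1:] ^ j * [:1, - x:] ^ n)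
      = (\<Sum>i\<le>n. poly_moment a (smult (real (n choose i) * (- x) ^ i) (monom 1 i * [:1, -1:] ^ j)))"
    by (simp add: sum_distrib_left poly_moment_sum mult.commute)
  also have "\<dots> = (\<Sum>i\<le>n. Gamma (real j + 1) * Gamma a / Gamma (a + real j + 1)
      * (real (n choose i) * (- x) ^ i * (pochhammer a i / pochhammer (a + real j + 1) i)))"
  proof (intro sum.cong refl)
    fix i
    have "a \<notin> \<int>\<^sub>\<le>\<^sub>0" "a + real j + 1 \<notin> \<int>\<^sub>\<le>\<^sub>0"
      using assms by (auto intro: not_nonpos_Ints_of_pos)
    then have "pochhammer a i = Gamma (a + real i) / Gamma a"
      "pochhammer (a + real j + 1) i = Gamma (a + real i + real j + 1) / Gamma (a + real j + 1)"
      using pochhammer_Gamma[of a i] pochhammer_Gamma[of "a + real j + 1" i]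
      by (simp_all add: algebra_simps)
    moreover have "Gamma a \<noteq> 0" "Gamma (a + real j + 1) \<noteq> 0"
      using assms by (auto intro!: Gamma_nonzero_pos)
    ultimately show "poly_moment a (smult (real (n choose i) * (- x) ^ i) (monom 1 i * [:1, -1:] ^ j))
      = Gamma (real j + 1) * Gamma a / Gamma (a + real j + 1)
      * (real (n choose i) * (- x) ^ i * (pochhammer a i / pochhammer (a + real j + 1) i))"
      using assms by (simp add: poly_moment_smult poly_moment_monom_mult
          poly_moment_one_minus_power field_simps)
  qed
  finally show ?thesis
    by (simp add: hyp2F1_neg_nat sum_distrib_left)
qed

text \<open>By Euler's integral the sum becomes a moment of a binomial expansion, and \<mu>(1 - z)(1
  - y) + (lam + \<mu>)z = (lam z + \<mu>)(1 - \<mu> r y). Both sums of the final formula have this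
  shape.\<close>

lemma binomial_sum_poly_moment_Euler:
  assumes "a > 0" "lam * z + \<mu> \<noteq> 0"
  defines "r \<equiv> (1 - z) / (lam * z + \<mu>)"
  shows "(\<Sum>j\<le>n. real (n choose j) * ((lam + \<mu>) * z) ^ (n - j) * (\<mu> * (1 - z)) ^ j
      * (Gamma (real j + 1) * Gamma a / Gamma (a + real j + 1))
      * hyp2F1 a (- real m) (a + real j + 1) (- (lam * r)))
    = (lam * z + \<mu>) ^ n * poly_moment a ([:1, - (\<mu> * r):] ^ n * [:1, lam * r:] ^ m)"
proof -
  have "(\<Sum>j\<le>n. real (n choose j) * ((lam + \<mu>) * z) ^ (n - j) * (\<mu> * (1 - z)) ^ j
      * (Gamma (real j + 1) * Gamma a / Gamma (a + real j + 1))
      * hyp2F1 a (- real m) (a + real j + 1) (- (lam * r)))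
    = (\<Sum>j\<le>n. poly_moment a (smult (real (n choose j) * ((lam + \<mu>) * z) ^ (n - j) * (\<mu> * (1 - z)) ^ j)
          ([:1, -1:] ^ j * [:1, lam * r:] ^ m)))"
    using poly_moment_Euler[OF assms(1), of _ "- (lam * r)" m]
    by (simp add: poly_moment_smult mult.assoc)
  also have "\<dots> = poly_moment a ((\<Sum>j\<le>n. smult (real (n choose j) * ((lam + \<mu>) * z) ^ (n - j)
      * (\<mu> * (1 - z)) ^ j) ([:1, -1:] ^ j)) * [:1, lam * r:] ^ m)"
    by (simp add: sum_distrib_right poly_moment_sum)
  also have "(\<Sum>j\<le>n. smult (real (n choose j) * ((lam + \<mu>) * z) ^ (n - j) * (\<mu> * (1 - z)) ^ j)
      ([:1, -1:] ^ j)) = (smult (\<mu> * (1 - z)) [:1, -1:] + [:(lam + \<mu>) * z:]) ^ n"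
    unfolding binomial_ring
    by (intro sum.cong refl) (simp add: smult_power of_nat_poly poly_const_pow mult_ac del: smult_pCons)
  also have "smult (\<mu> * (1 - z)) [:1, -1:] + [:(lam + \<mu>) * z:]
      = smult (lam * z + \<mu>) [:1, - (\<mu> * r):]"
    using assms(2) by (simp add: r_def field_simps)
  finally show ?thesis
    by (simp add: smult_power poly_moment_smult del: smult_pCons)
qed

subsection \<open>Decay for the level generator\<close>

text \<open>The birth rate vanishes at \<open>k = N\<close>, so the value of \<open>\<phi>\<close>
  at \<open>N + 1\<close> has no effect there. The death rate \<open>\<mu> * (N + k)\<close> does
  not vanish at \<open>k = 0\<close> and is cut off by hand; this reflection later causes the
  boundary term.\<close>

definition level_generator ::
    "nat \<Rightarrow> real \<Rightarrow> real \<Rightarrow> real \<Rightarrow> (nat \<Rightarrow> real) \<Rightarrow> nat \<Rightarrow> real" where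
  "level_generator N lam \<mu> \<xi> \<phi> k =
     lam * (real N - real k) * (\<phi> (k + 1) - \<phi> k)
     + (if k = 0 then 0 else \<mu> * (real N + real k) * (\<phi> (k - 1) - \<phi> k))
     + \<xi> * (\<phi> 0 - \<phi> k)"

text \<open>The reflected Ehrenfest chain (no catastrophes) is reversible with respect to the weights
  \<open>(lam / \<mu>) ^ k * (2 * N choose (N + k))\<close>, so its Dirichlet form is nonnegative.\<close>

lemma reversible_birth_death:
  fixes \<psi> :: "nat \<Rightarrow> real" and N :: nat
  assumes "lam > 0" "\<mu> > 0"
  defines "w \<equiv> \<lambda>k. (lam / \<mu>) ^ k * real (2 * N choose (N + k))"
  shows "(\<Sum>k\<le>N. w k * \<psi> k * level_generator N lam \<mu> 0 \<psi> k) \<le> 0"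
proof -
  define D where "D k = w k * (lam * (real N - real k)) * (\<psi> (Suc k) - \<psi> k)" for k
  \<comment> \<open>Detailed balance for the edge between \<open>k\<close> and \<open>Suc k\<close>,
    from the absorption identity (n + 1) C(2N, n + 1) = (2N - n) C(2N, n) with n = N + k.\<close>
  have bal: "w (Suc k) * (\<mu> * (real N + real (Suc k))) = w k * (lam * (real N - real k))"
    if "k < N" for k
  proof -
    have "Suc (N + k) * (2 * N choose Suc (N + k)) = (2 * N choose (N + k)) * (2 * N - (N + k))"
      by (simp only: binomial_absorption binomial_absorb_comp[symmetric] mult.commute)
    then have "real (Suc (N + k) * (2 * N choose Suc (N + k)))
        = real ((2 * N choose (N + k)) * (N - k))"
      by simp
    then have "(real N + real (Suc k)) * real (2 * N choose Suc (N + k))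
        = real (2 * N choose (N + k)) * (real N - real k)"
      using that by (simp only: of_nat_mult of_nat_diff less_imp_le) (simp add: algebra_simps)
    then have "(lam / \<mu>) ^ Suc k * \<mu> * ((real N + real (Suc k)) * real (2 * N choose Suc (N + k)))
        = (lam / \<mu>) ^ k * lam * (real (2 * N choose (N + k)) * (real N - real k))"
      using assms by (simp del: of_nat_Suc)
    then show ?thesis
      by (simp only: w_def add_Suc_right mult_ac)
  qed
  \<comment> \<open>Summation by parts. The boundary term vanishes at \<open>n = N\<close> because
    \<open>D N\<close> contains the factor \<open>N - N\<close>.\<close>
  have *: "(\<Sum>k\<le>n. w k * \<psi> k * level_generator N lam \<mu> 0 \<psi> k)
      = \<psi> n * D n - (\<Sum>k<n. D k * (\<psi> (Suc k) - \<psi> k))" if "n \<le> N" for n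
    using that
  proof (induction n)
    case (Suc n)
    have "w (Suc n) * \<psi> (Suc n) * level_generator N lam \<mu> 0 \<psi> (Suc n)
        = \<psi> (Suc n) * D (Suc n)
          + \<psi> (Suc n) * (w (Suc n) * (\<mu> * (real N + real (Suc n)))) * (\<psi> n - \<psi> (Suc n))"
      by (simp add: level_generator_def D_def algebra_simps)
    also have "\<dots> = \<psi> (Suc n) * D (Suc n) - \<psi> (Suc n) * D n"
      using Suc.prems by (subst bal) (auto simp: D_def algebra_simps)
    finally show ?case
      using Suc by (simp add: algebra_simps)
  qed (simp add: level_generator_def D_def)
  have "0 \<le> D k * (\<psi> (Suc k) - \<psi> k)" if "k < N" for k
  proof -
    have "D k * (\<psi> (Suc k) - \<psi> k) = w k * (lam * (real N - real k)) * (\<psi> (Suc k) - \<psi> k)\<^sup>2"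
      by (simp add: D_def power2_eq_square)
    then show ?thesis
      using that assms by (simp add: w_def)
  qed
  then have "0 \<le> (\<Sum>k<N. D k * (\<psi> (Suc k) - \<psi> k))"
    by (intro sum_nonneg) auto
  then show ?thesis
    using *[of N] by (simp add: D_def)
qed

text \<open>Gronwall's argument: \<open>exp (\<xi> * t) * f t\<close> is nonincreasing. The
  comparison starts at time \<open>1\<close>, since the hypotheses concern positive times
  only.\<close>

lemma tendsto_0_of_deriv_le:
  fixes f f' :: "real \<Rightarrow> real"
  assumes "\<xi> > 0"
    and der: "\<And>t. t > 0 \<Longrightarrow> (f has_real_derivative f' t) (at t)"
    and le: "\<And>t. t > 0 \<Longrightarrow> f' t \<le> - \<xi> * f t"
    and nonneg: "\<And>t. t > 0 \<Longrightarrow> 0 \<le> f t"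
  shows "(f \<longlongrightarrow> 0) at_top"
proof -
  have bound: "exp (\<xi> * t) * f t \<le> exp \<xi> * f 1" if "t \<ge> 1" for t
  proof -
    have "exp (\<xi> * t) * f t \<le> exp (\<xi> * 1) * f 1"
    proof (rule DERIV_nonpos_imp_nonincreasing[OF that], intro exI conjI)
      fix x :: real assume "1 \<le> x" "x \<le> t"
      then show "((\<lambda>t. exp (\<xi> * t) * f t) has_real_derivative exp (\<xi> * x) * (f' x + \<xi> * f x)) (at x)"
        by (auto intro!: derivative_eq_intros der simp: algebra_simps)
      show "exp (\<xi> * x) * (f' x + \<xi> * f x) \<le> 0"
        using le[of x] \<open>1 \<le> x\<close> by (intro mult_nonneg_nonpos) auto
    qed
    then show ?thesis by simp
  qed
  have "((\<lambda>t. exp \<xi> * f 1 * exp (- (\<xi> * t))) \<longlongrightarrow> 0) at_top"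
    using assms(1) by real_asymp
  moreover have "\<forall>\<^sub>F t in at_top. norm (f t) \<le> exp \<xi> * f 1 * exp (- (\<xi> * t))"
    using eventually_ge_at_top[of 1]
  proof eventually_elim
    case (elim t)
    then have "f t = exp (- (\<xi> * t)) * (exp (\<xi> * t) * f t)"
      by (simp add: exp_minus)
    also have "\<dots> \<le> exp (- (\<xi> * t)) * (exp \<xi> * f 1)"
      using bound[OF elim] by (intro mult_left_mono) auto
    finally show ?case
      using nonneg[of t] elim by (simp add: mult_ac)
  qed
  ultimately show ?thesis
    by (rule Lim_null_comparison[rotated])
qed

lemma level_generator_sum:
  "level_generator N lam \<mu> \<xi> (\<lambda>k. \<Sum>j\<in>S. y j * \<phi> j k) i
     = (\<Sum>j\<in>S. y j * level_generator N lam \<mu> \<xi> (\<phi> j) i)"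
  by (simp add: level_generator_def sum_distrib_left sum_subtractf sum.distrib algebra_simps)

text \<open>Permits replacing a test function by its expansion in the indicators of the levels
  \<open>0..N\<close>, which need not agree with it at \<open>N + 1\<close>.\<close>

lemma level_generator_cong:
  assumes "\<And>k. k \<le> N \<Longrightarrow> \<phi> k = \<phi>' k" "k \<le> N"
  shows "level_generator N lam \<mu> \<xi> \<phi> k = level_generator N lam \<mu> \<xi> \<phi>' k"
proof (cases "k = N")
  case False
  with assms show ?thesis
    by (simp add: level_generator_def)
qed (use assms in \<open>simp add: level_generator_def\<close>)

text \<open>The hypothesis is the forward equation f' = f G in weak form. The row vector
  \<open>v = f G\<close> is the derivative of \<open>f\<close>; it solves the same linear equation,
  has total mass \<open>0\<close>, and its energy \<open>E\<close> decays at rate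
  \<open>2 * \<xi>\<close>.\<close>

lemma level_generator_mean_tendsto_0:
  fixes f :: "real \<Rightarrow> nat \<Rightarrow> real"
  assumes pos: "lam > 0" "\<mu> > 0" "\<xi> > 0"
    and der: "\<And>\<phi> t. t > 0 \<Longrightarrow> ((\<lambda>t. \<Sum>k\<le>N. f t k * \<phi> k) has_real_derivative
        (\<Sum>k\<le>N. f t k * level_generator N lam \<mu> \<xi> \<phi> k)) (at t)"
  shows "((\<lambda>t. \<Sum>k\<le>N. f t k * level_generator N lam \<mu> \<xi> \<phi> k) \<longlongrightarrow> 0) at_top"
proof -
  define G where "G = level_generator N lam \<mu> \<xi>"
  define e :: "nat \<Rightarrow> nat \<Rightarrow> real" where "e j k = (if k = j then 1 else 0)" for j k
  define v where "v t j = (\<Sum>k\<le>N. f t k * G (e j) k)" for t j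
  define w where "w k = (lam / \<mu>) ^ k * real (2 * N choose (N + k))" for k
  have w_pos: "w k > 0" if "k \<le> N" for k
    using that pos by (simp add: w_def)
  have v_mean: "(\<Sum>j\<le>N. v t j * \<phi> j) = (\<Sum>k\<le>N. f t k * G \<phi> k)" for t \<phi>
  proof -
    have "(\<Sum>k\<le>N. f t k * G \<phi> k) = (\<Sum>k\<le>N. f t k * G (\<lambda>i. \<Sum>j\<le>N. \<phi> j * e j i) k)"
      unfolding G_def
      by (intro sum.cong refl arg_cong2[where f = "(*)"] level_generator_cong)
        (auto simp: e_def if_distrib sum.delta cong: if_cong)
    also have "\<dots> = (\<Sum>k\<le>N. \<Sum>j\<le>N. f t k * (\<phi> j * G (e j) k))"
      by (simp add: G_def level_generator_sum sum_distrib_left)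
    also have "\<dots> = (\<Sum>j\<le>N. v t j * \<phi> j)"
      by (subst sum.swap) (simp add: v_def sum_distrib_left sum_distrib_right mult_ac)
    finally show ?thesis ..
  qed
  \<comment> \<open>The forward equation is tested against \<open>G (e j)\<close>;
    \<open>v_mean\<close> then rewrites f G G as v G.\<close>
  have v_der: "((\<lambda>t. v t j) has_real_derivative (\<Sum>k\<le>N. v t k * G (e j) k)) (at t)" if "t > 0" for t j
    unfolding v_mean using der[OF that, of "G (e j)"] by (simp add: v_def G_def)
  have v_sum: "(\<Sum>k\<le>N. v t k) = 0" for t
    using v_mean[of t "\<lambda>_. 1"] by (simp add: G_def level_generator_def cong: if_cong)
  define E where "E t = (\<Sum>k\<le>N. (v t k)\<^sup>2 / w k)" for t
  define E' where "E' t = (\<Sum>j\<le>N. 2 * (v t j / w j) * (\<Sum>k\<le>N. v t k * G (e j) k))" for t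
  have E_der: "(E has_real_derivative E' t) (at t)" if "t > 0" for t
    unfolding E_def[abs_def] E'_def
    by (auto intro!: derivative_eq_intros v_der[OF that] sum.cong dest: w_pos simp: mult_ac)
  have E_le: "E' t \<le> - (2 * \<xi>) * E t" for t
  proof -
    \<comment> \<open>The density of \<open>v\<close> with respect to the reversible weights: moving
      \<open>G\<close> from the vector to the function makes \<open>E'\<close> twice the weighted
      quadratic form of \<open>G\<close> at \<open>\<psi>\<close>.\<close>
    define \<psi> where "\<psi> k = v t k / w k" for k
    have v_eq: "v t k = w k * \<psi> k" if "k \<le> N" for k
      using w_pos[OF that] by (simp add: \<psi>_def)
    have "(\<Sum>j\<le>N. \<psi> j * (\<Sum>k\<le>N. v t k * G (e j) k)) = (\<Sum>k\<le>N. v t k * (\<Sum>j\<le>N. \<psi> j * G (e j) k))"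
      unfolding sum_distrib_left by (subst sum.swap) (simp add: mult_ac)
    also have "\<dots> = (\<Sum>k\<le>N. v t k * G \<psi> k)"
      unfolding G_def level_generator_sum[symmetric]
      by (intro sum.cong refl arg_cong2[where f = "(*)"] level_generator_cong)
        (auto simp: e_def if_distrib sum.delta cong: if_cong)
    \<comment> \<open>The catastrophes contribute \<open>\<xi> * (\<psi> 0 - \<psi> k)\<close>. Its
      first part pairs with \<open>v\<close> to \<open>0\<close> by \<open>v_sum\<close>, the second
      gives \<open>- \<xi> * E t\<close>, and the birth-death part is at most
      \<open>0\<close>.\<close>
    also have "\<dots> = (\<Sum>k\<le>N. w k * \<psi> k * level_generator N lam \<mu> 0 \<psi> k
        + \<xi> * \<psi> 0 * v t k - \<xi> * ((v t k)\<^sup>2 / w k))"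
    proof (intro sum.cong refl)
      fix k assume "k \<in> {..N}"
      then have k: "k \<le> N" by simp
      have G0: "G \<psi> k = level_generator N lam \<mu> 0 \<psi> k + \<xi> * (\<psi> 0 - \<psi> k)"
        by (simp add: G_def level_generator_def)
      have "(v t k)\<^sup>2 / w k = v t k * \<psi> k"
        by (simp add: \<psi>_def power2_eq_square)
      then show "v t k * G \<psi> k = w k * \<psi> k * level_generator N lam \<mu> 0 \<psi> k
          + \<xi> * \<psi> 0 * v t k - \<xi> * ((v t k)\<^sup>2 / w k)"
        unfolding G0 v_eq[OF k, symmetric] by (simp add: algebra_simps)
    qed
    also have "\<dots> \<le> - \<xi> * E t"
      using reversible_birth_death[OF pos(1,2), of N \<psi>] v_sum[of t]
      by (simp add: sum.distrib sum_subtractf E_def w_def del: times_divide_eq_right flip: sum_distrib_left)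
    finally show ?thesis
      by (simp add: E'_def \<psi>_def mult.assoc del: times_divide_eq_right times_divide_eq_left
          flip: sum_distrib_left)
  qed
  have E_lim: "(E \<longlongrightarrow> 0) at_top"
    by (rule tendsto_0_of_deriv_le[where \<xi> = "2 * \<xi>" and f' = E'])
      (use pos E_der E_le in \<open>auto simp: E_def w_pos less_imp_le intro!: sum_nonneg\<close>)
  have v_lim: "((\<lambda>t. v t j) \<longlongrightarrow> 0) at_top" if "j \<le> N" for j
  proof -
    have "norm ((v t j)\<^sup>2) \<le> w j * E t" for t
    proof -
      have "(v t j)\<^sup>2 / w j \<le> E t"
        unfolding E_def using that w_pos
        by (intro member_le_sum) (auto intro!: divide_nonneg_pos)
      then show ?thesis
        using w_pos[OF that] by (simp add: field_simps)
    qed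
    then have "((\<lambda>t. (v t j)\<^sup>2) \<longlongrightarrow> 0) at_top"
      by (rule Lim_null_comparison[OF always_eventually, OF allI])
        (rule tendsto_mult_right_zero[OF E_lim])
    then have "((\<lambda>t. sqrt ((v t j)\<^sup>2)) \<longlongrightarrow> sqrt 0) at_top"
      by (rule tendsto_real_sqrt)
    then show ?thesis
      by (simp add: tendsto_rabs_zero_iff)
  qed
  have "((\<lambda>t. \<Sum>j\<le>N. v t j * \<phi> j) \<longlongrightarrow> (\<Sum>j\<le>N. 0 * \<phi> j)) at_top"
    by (intro tendsto_intros v_lim) auto
  then show ?thesis
    by (simp add: v_mean G_def)
qed

subsection \<open>The level process\<close>

text \<open>The Chapman--Kolmogorov equation with a short last step \<open>h\<close> expresses an
  increment of the mean through \<open>D\<close>, whose quotient by \<open>h\<close> tends to the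
  generator. For the left derivative the step starts at \<open>t - h\<close>, which requires left
  continuity of \<open>p\<close>.\<close>

lemma transition_function_mean_deriv:
  assumes S: "finite S" "transition_function S p" "has_transition_rates S p q"
    and i: "i \<in> S" and t: "t > 0"
  shows "((\<lambda>t. \<Sum>s\<in>S. p t i s * \<phi> s) has_real_derivative
     (\<Sum>s\<in>S. p t i s * (\<Sum>s'\<in>S. q s s' * (\<phi> s' - \<phi> s)))) (at t)"
proof -
  define D where "D \<psi> h s = (\<Sum>s'\<in>S. p h s s' * \<psi> s') - \<psi> s" for \<psi> h s
  define U where "U \<psi> t = (\<Sum>s\<in>S. p t i s * \<psi> s)" for \<psi> t
  define Q where "Q \<psi> s = (\<Sum>s'\<in>S. q s s' * (\<psi> s' - \<psi> s))" for \<psi> s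
  have p_nonneg: "0 \<le> p h s s'" and p_sum: "(\<Sum>s'\<in>S. p h s s') = 1"
    if "h \<ge> 0" "s \<in> S" "s' \<in> S" for h s s'
    using S(2) that by (auto simp: transition_function_def stochastic_on_def)
  have p_le: "p h s s' \<le> 1" if "h \<ge> 0" "s \<in> S" "s' \<in> S" for h s s'
    using member_le_sum[OF that(3), of "p h s"] p_nonneg p_sum that S(1) by auto
  \<comment> \<open>Rows sum to \<open>1\<close>, so \<open>D\<close> is a sum of differences
    \<open>\<psi> s' - \<psi> s\<close>. The diagonal term drops out and the off-diagonal rates
    suffice.\<close>
  have D_lim: "((\<lambda>h. D \<psi> h s / h) \<longlongrightarrow> Q \<psi> s) (at_right 0)" if s: "s \<in> S" for \<psi> s
  proof -
    have "((\<lambda>h. p h s s' / h * (\<psi> s' - \<psi> s)) \<longlongrightarrow> q s s' * (\<psi> s' - \<psi> s)) (at_right 0)"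
      if "s' \<in> S" for s'
    proof (cases "s = s'")
      case False
      then show ?thesis
        using S(3) s that by (intro tendsto_mult_right) (auto simp: has_transition_rates_def)
    qed simp
    then have "((\<lambda>h. \<Sum>s'\<in>S. p h s s' / h * (\<psi> s' - \<psi> s)) \<longlongrightarrow> Q \<psi> s) (at_right 0)"
      unfolding Q_def by (intro tendsto_sum) auto
    moreover have "\<forall>\<^sub>F h in at_right 0. (\<Sum>s'\<in>S. p h s s' / h * (\<psi> s' - \<psi> s)) = D \<psi> h s / h"
      using eventually_at_right_less[of 0]
    proof eventually_elim
      case (elim h)
      have "(\<Sum>s'\<in>S. p h s s' / h * (\<psi> s' - \<psi> s))
          = ((\<Sum>s'\<in>S. p h s s' * \<psi> s') - \<psi> s * (\<Sum>s'\<in>S. p h s s')) / h"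
        by (simp add: sum_divide_distrib sum_distrib_left sum_subtractf algebra_simps diff_divide_distrib)
      then show ?case
        using elim s p_sum by (simp add: D_def)
    qed
    ultimately show ?thesis
      by (rule Lim_transform_eventually)
  qed
  have D_0: "((\<lambda>h. D \<psi> h s) \<longlongrightarrow> 0) (at_right 0)" if s: "s \<in> S" for \<psi> s
  proof -
    have "((\<lambda>h. h * (D \<psi> h s / h)) \<longlongrightarrow> 0 * Q \<psi> s) (at_right 0)"
      by (intro tendsto_intros D_lim s)
    moreover have "\<forall>\<^sub>F h in at_right 0. h * (D \<psi> h s / h) = D \<psi> h s"
      using eventually_at_right_less[of 0] by eventually_elim simp
    ultimately show ?thesis
      by (auto elim: Lim_transform_eventually)
  qed
  have U_diff: "U \<psi> (t + h) - U \<psi> t = (\<Sum>s\<in>S. p t i s * D \<psi> h s)" if "t \<ge> 0" "h \<ge> 0" for \<psi> t h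
  proof -
    have "U \<psi> (t + h) = (\<Sum>s\<in>S. (\<Sum>k\<in>S. p t i k * p h k s) * \<psi> s)"
      using S(2) that i unfolding U_def by (intro sum.cong refl) (auto simp: transition_function_def)
    also have "\<dots> = (\<Sum>s\<in>S. p t i s * (\<Sum>s'\<in>S. p h s s' * \<psi> s'))"
      unfolding sum_distrib_left sum_distrib_right by (subst sum.swap) (simp add: mult_ac)
    finally show ?thesis
      by (simp add: U_def D_def algebra_simps sum_subtractf)
  qed
  \<comment> \<open>Transition probabilities lie between \<open>0\<close> and \<open>1\<close>, so
    the bound by \<open>D\<close> is uniform in the starting time \<open>t - h\<close>. Indicator
    functions then give the continuity of \<open>p\<close> itself.\<close>
  have U_left: "((\<lambda>h. U \<psi> (t - h)) \<longlongrightarrow> U \<psi> t) (at_right 0)" for \<psi>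
  proof -
    have "((\<lambda>h. \<Sum>s\<in>S. \<bar>D \<psi> h s\<bar>) \<longlongrightarrow> 0) (at_right 0)"
      by (intro tendsto_null_sum tendsto_rabs_zero D_0)
    moreover have "\<forall>\<^sub>F h in at_right 0. norm (U \<psi> (t - h) - U \<psi> t) \<le> (\<Sum>s\<in>S. \<bar>D \<psi> h s\<bar>)"
      using eventually_at_right_real[OF t]
    proof eventually_elim
      case (elim h)
      then have "norm (U \<psi> (t - h) - U \<psi> t) = \<bar>\<Sum>s\<in>S. p (t - h) i s * D \<psi> h s\<bar>"
        using U_diff[of "t - h" h \<psi>] by simp
      also have "\<dots> \<le> (\<Sum>s\<in>S. \<bar>p (t - h) i s * D \<psi> h s\<bar>)"
        by (rule sum_abs)
      also have "\<dots> \<le> (\<Sum>s\<in>S. 1 * \<bar>D \<psi> h s\<bar>)"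
        unfolding abs_mult using elim i p_nonneg p_le by (intro sum_mono mult_right_mono) auto
      finally show ?case by simp
    qed
    ultimately have "((\<lambda>h. U \<psi> (t - h) - U \<psi> t) \<longlongrightarrow> 0) (at_right 0)"
      by (rule Lim_null_comparison[rotated])
    then show ?thesis
      by (rule LIM_zero_cancel)
  qed
  have p_left: "((\<lambda>h. p (t - h) i s) \<longlongrightarrow> p t i s) (at_right 0)" if "s \<in> S" for s
  proof -
    have "U (\<lambda>s'. if s' = s then 1 else 0) t' = p t' i s" for t'
      using that S(1) by (simp add: U_def if_distrib cong: if_cong)
    then show ?thesis
      using U_left[of "\<lambda>s'. if s' = s then 1 else 0"] by simp
  qed
  let ?L = "\<Sum>s\<in>S. p t i s * Q \<phi> s"
  have "((\<lambda>h. (U \<phi> (t + h) - U \<phi> t) / h) \<longlongrightarrow> ?L) (at_right 0)"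
  proof -
    have "((\<lambda>h. \<Sum>s\<in>S. p t i s * (D \<phi> h s / h)) \<longlongrightarrow> ?L) (at_right 0)"
      by (intro tendsto_intros D_lim)
    moreover have "\<forall>\<^sub>F h in at_right 0.
        (\<Sum>s\<in>S. p t i s * (D \<phi> h s / h)) = (U \<phi> (t + h) - U \<phi> t) / h"
      using eventually_at_right_less[of 0]
      by eventually_elim (use t in \<open>simp add: U_diff sum_divide_distrib\<close>)
    ultimately show ?thesis
      by (rule Lim_transform_eventually)
  qed
  moreover have "((\<lambda>h. (U \<phi> (t + h) - U \<phi> t) / h) \<longlongrightarrow> ?L) (at_left 0)"
  proof -
    have "((\<lambda>h. \<Sum>s\<in>S. p (t - h) i s * (D \<phi> h s / h)) \<longlongrightarrow> ?L) (at_right 0)"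
      by (intro tendsto_intros D_lim p_left)
    moreover have "\<forall>\<^sub>F h in at_right 0.
        (\<Sum>s\<in>S. p (t - h) i s * (D \<phi> h s / h)) = (U \<phi> (t + - h) - U \<phi> t) / - h"
      using eventually_at_right_real[OF t]
    proof eventually_elim
      case (elim h)
      then have "U \<phi> t - U \<phi> (t - h) = (\<Sum>s\<in>S. p (t - h) i s * D \<phi> h s)"
        using U_diff[of "t - h" h \<phi>] by simp
      then show ?case
        by (simp add: minus_divide_left flip: sum_divide_distrib)
    qed
    ultimately have "((\<lambda>h. (U \<phi> (t + - h) - U \<phi> t) / - h) \<longlongrightarrow> ?L) (at_right 0)"
      by (rule Lim_transform_eventually)
    then show ?thesis
      by (simp add: filterlim_at_left_to_right[of _ _ 0])
  qed
  ultimately have "((\<lambda>h. (U \<phi> (t + h) - U \<phi> t) / h) \<longlongrightarrow> ?L) (at 0)"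
    by (simp add: filterlim_split_at)
  then show ?thesis
    by (simp add: DERIV_def U_def Q_def)
qed

text \<open>The Markov property is used with time \<open>0\<close> as its only conditioning time
  (\<open>n = 0\<close>). The event \<open>X 0 = x0\<close> has probability \<open>1\<close>, so
  conditioning on it does not change probabilities.\<close>

lemma ct_markov_chain_mean:
  assumes X: "ct_markov_chain M X S q" and x0: "AE \<omega> in M. X 0 \<omega> = x0" "x0 \<in> S"
  obtains p where "transition_function S p" "has_transition_rates S p q"
    "\<And>\<phi> t. t > 0 \<Longrightarrow> (\<integral>\<omega>. \<phi> (X t \<omega>) \<partial>M) = (\<Sum>s\<in>S. p t x0 s * (\<phi> s :: real))"
proof -
  interpret prob_space M
    using X by (simp add: ct_markov_chain_def)
  have fin: "finite S" and meas: "\<And>t. t \<ge> 0 \<Longrightarrow> X t \<in> measurable M (count_space S)"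
    using X by (auto simp: ct_markov_chain_def)
  obtain p where p: "transition_function S p" "has_transition_rates S p q"
    and cond: "\<And>(n::nat) s t x j. 0 \<le> s 0 \<and> (\<forall>i<n. s i < s (Suc i)) \<and> s n < t \<and> (\<forall>i\<le>n. x i \<in> S)
        \<and> j \<in> S \<and> \<P>(\<omega> in M. \<forall>i\<le>n. X (s i) \<omega> = x i) > 0 \<longrightarrow>
        \<P>(\<omega> in M. X t \<omega> = j \<bar> \<forall>i\<le>n. X (s i) \<omega> = x i) = p (t - s n) (x n) j"
    using X unfolding ct_markov_chain_def by blast
  have sets_eq: "{\<omega>\<in>space M. X t \<omega> = s} \<in> sets M" if "t \<ge> 0" "s \<in> S" for t s
    using measurable_sets[OF meas[OF that(1)], of "{s}"] that(2)
    by (simp add: vimage_def Int_def conj_commute)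
  have prob0: "\<P>(\<omega> in M. X 0 \<omega> = x0) = 1"
    using x0 sets_eq[of 0 x0] by (intro prob_Collect_eq_1[THEN iffD2]) auto
  have prob: "\<P>(\<omega> in M. X t \<omega> = s) = p t x0 s" if "t > 0" "s \<in> S" for t s
  proof -
    have "\<P>(\<omega> in M. X t \<omega> = s \<bar> X 0 \<omega> = x0) = p t x0 s"
      using cond[of "\<lambda>_. 0" 0 t "\<lambda>_. x0" s] that x0(2) prob0 by simp
    moreover have "\<P>(\<omega> in M. X t \<omega> = s \<and> X 0 \<omega> = x0) = \<P>(\<omega> in M. X t \<omega> = s)"
      using x0(1) sets_eq that x0(2)
      by (intro finite_measure_eq_AE) (auto intro!: sets.sets_Collect_conj)
    ultimately show ?thesis
      by (simp add: cond_prob_def prob0)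
  qed
  have "(\<integral>\<omega>. \<phi> (X t \<omega>) \<partial>M) = (\<Sum>s\<in>S. p t x0 s * \<phi> s)" if t: "t > 0" for t and \<phi> :: "_ \<Rightarrow> real"
  proof -
    have "(\<integral>\<omega>. \<phi> (X t \<omega>) \<partial>M)
        = (\<integral>\<omega>. (\<Sum>s\<in>S. \<phi> s * indicator {\<omega>\<in>space M. X t \<omega> = s} \<omega>) \<partial>M)"
    proof (intro Bochner_Integration.integral_cong refl)
      fix \<omega> assume \<omega>: "\<omega> \<in> space M"
      then have "X t \<omega> \<in> S"
        using measurable_space[OF meas[of t]] t by auto
      then show "\<phi> (X t \<omega>) = (\<Sum>s\<in>S. \<phi> s * indicator {\<omega>\<in>space M. X t \<omega> = s} \<omega>)"
        using \<omega> fin by (simp add: indicator_def if_distrib cong: if_cong)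
    qed
    also have "\<dots> = (\<Sum>s\<in>S. \<phi> s * \<P>(\<omega> in M. X t \<omega> = s))"
      using sets_eq[of t] t
      by (subst Bochner_Integration.integral_sum) (auto simp: emeasure_eq_measure intro!: sum.cong)
    finally show ?thesis
      using prob[OF t] by (simp add: mult.commute)
  qed
  with p that show ?thesis by blast
qed

text \<open>The chain lumps to its levels: leaving level \<open>0\<close>, the phase probabilities
  sum to \<open>1\<close>, and from every other level the phase is kept. The result therefore does
  not depend on \<open>l\<close>.\<close>

lemma sum_catastrophe_rates:
  assumes c: "stochastic_on {1..d} c" and k: "k \<le> N" and l: "l \<in> {1..d}" and N: "N \<ge> 1"
  shows "(\<Sum>s\<in>{0..N} \<times> {1..d}. catastrophe_rates N lam \<mu> \<xi> c (k, l) s * (\<phi> (fst s) - \<phi> k))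
    = level_generator N lam \<mu> \<xi> \<phi> k"
proof -
  have "(\<Sum>s\<in>{0..N} \<times> {1..d}. catastrophe_rates N lam \<mu> \<xi> c (k, l) s * (\<phi> (fst s) - \<phi> k))
      = (\<Sum>k'\<le>N. (\<Sum>j\<in>{1..d}. catastrophe_rates N lam \<mu> \<xi> c (k, l) (k', j)) * (\<phi> k' - \<phi> k))"
    unfolding atLeast0AtMost sum_distrib_right sum.cartesian_product
    by (intro sum.cong) auto
  also have "\<dots> = level_generator N lam \<mu> \<xi> \<phi> k"
  proof (cases "k = 0")
    case True
    have "(\<Sum>j\<in>{1..d}. catastrophe_rates N lam \<mu> \<xi> c (k, l) (k', j))
        = (if k' = 1 then lam * real N else 0)" for k'
      using c l by (simp add: True catastrophe_rates_def stochastic_on_def flip: sum_distrib_right)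
    then show ?thesis
      using True N by (simp add: level_generator_def if_distrib[of "\<lambda>x. x * _"] cong: if_cong)
  next
    case False
    define \<psi> where "\<psi> k' = \<phi> k' - \<phi> k" for k'
    have "(\<Sum>j\<in>{1..d}. catastrophe_rates N lam \<mu> \<xi> c (k, l) (k', j))
        = (if k' = k + 1 then (if k < N then lam * (real N - real k) else 0) else 0)
        + (if k' = k - 1 then \<mu> * (real N + real k) else 0) + (if k' = 0 then \<xi> else 0)" for k'
    proof -
      have "catastrophe_rates N lam \<mu> \<xi> c (k, l) (k', j) = (if j = l then
          (if k' = k + 1 then (if k < N then lam * (real N - real k) else 0) else 0)
        + (if k' = k - 1 then \<mu> * (real N + real k) else 0) + (if k' = 0 then \<xi> else 0) else 0)" for j
        using False k by (auto simp: catastrophe_rates_def)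
      then show ?thesis
        using l by (simp del: One_nat_def)
    qed
    then have "(\<Sum>k'\<le>N. (\<Sum>j\<in>{1..d}. catastrophe_rates N lam \<mu> \<xi> c (k, l) (k', j)) * \<psi> k')
      = (\<Sum>k'\<le>N. (if k' = k + 1 then (if k < N then lam * (real N - real k) else 0) * \<psi> k' else 0)
        + (if k' = k - 1 then \<mu> * (real N + real k) * \<psi> k' else 0)
        + (if k' = 0 then \<xi> * \<psi> k' else 0))"
      by (intro sum.cong refl) (auto simp: algebra_simps)
    also have "\<dots> = level_generator N lam \<mu> \<xi> \<phi> k"
      using False k by (auto simp: sum.distrib level_generator_def \<psi>_def)
    finally show ?thesis
      by (simp add: \<psi>_def)
  qed
  finally show ?thesis .
qed

text \<open>\<open>f t\<close> is the law of the level, obtained by summing transition probabilities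
  over phases. Lumping closes the forward equation in \<open>f\<close>.\<close>

lemma catastrophe_level_distribution:
  assumes "N \<ge> 1" "stochastic_on {1..d} c" "l0 \<in> {1..d}"
    and "ct_markov_chain M X ({0..N} \<times> {1..d}) (catastrophe_rates N lam \<mu> \<xi> c)"
    and "AE \<omega> in M. X 0 \<omega> = (0, l0)"
  obtains f :: "real \<Rightarrow> nat \<Rightarrow> real" where
    "\<And>t. t > 0 \<Longrightarrow> (\<Sum>k\<le>N. f t k) = 1"
    "\<And>t \<phi>. t > 0 \<Longrightarrow> (\<integral>\<omega>. \<phi> (fst (X t \<omega>)) \<partial>M) = (\<Sum>k\<le>N. f t k * \<phi> k)"
    "\<And>t \<phi>. t > 0 \<Longrightarrow> ((\<lambda>t. \<Sum>k\<le>N. f t k * \<phi> k) has_real_derivative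
        (\<Sum>k\<le>N. f t k * level_generator N lam \<mu> \<xi> \<phi> k)) (at t)"
proof -
  let ?S = "{0..N} \<times> {1..d}"
  obtain p where p: "transition_function ?S p"
      "has_transition_rates ?S p (catastrophe_rates N lam \<mu> \<xi> c)"
    and mean: "\<And>\<phi> t. t > 0 \<Longrightarrow> (\<integral>\<omega>. \<phi> (X t \<omega>) \<partial>M) = (\<Sum>s\<in>?S. p t (0, l0) s * (\<phi> s :: real))"
    using ct_markov_chain_mean[OF assms(4,5)] assms(3) by auto
  define f where "f t k = (\<Sum>l\<in>{1..d}. p t (0, l0) (k, l))" for t k
  have f: "(\<Sum>s\<in>?S. p t (0, l0) s * \<phi> (fst s)) = (\<Sum>k\<le>N. f t k * \<phi> k)" for t \<phi>
    unfolding f_def atLeast0AtMost sum_distrib_right sum.cartesian_product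
    by (intro sum.cong) auto
  show ?thesis
  proof (rule that[of f])
    fix t :: real and \<phi> :: "nat \<Rightarrow> real" assume t: "t > 0"
    show "(\<Sum>k\<le>N. f t k) = 1"
      using f[of t "\<lambda>_. 1"] p(1) t assms(3)
      by (simp add: transition_function_def stochastic_on_def)
    show "(\<integral>\<omega>. \<phi> (fst (X t \<omega>)) \<partial>M) = (\<Sum>k\<le>N. f t k * \<phi> k)"
      using mean[OF t, of "\<lambda>s. \<phi> (fst s)"] f by simp
    have "((\<lambda>t. \<Sum>s\<in>?S. p t (0, l0) s * \<phi> (fst s)) has_real_derivative
        (\<Sum>s\<in>?S. p t (0, l0) s *
          (\<Sum>s'\<in>?S. catastrophe_rates N lam \<mu> \<xi> c s s' * (\<phi> (fst s') - \<phi> (fst s))))) (at t)"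
      using assms(3) t by (intro transition_function_mean_deriv p) auto
    also have "(\<Sum>s\<in>?S. p t (0, l0) s *
          (\<Sum>s'\<in>?S. catastrophe_rates N lam \<mu> \<xi> c s s' * (\<phi> (fst s') - \<phi> (fst s))))
        = (\<Sum>s\<in>?S. p t (0, l0) s * level_generator N lam \<mu> \<xi> \<phi> (fst s))"
    proof (intro sum.cong refl arg_cong2[where f = "(*)"])
      fix s assume "s \<in> ?S"
      then show "(\<Sum>s'\<in>?S. catastrophe_rates N lam \<mu> \<xi> c s s' * (\<phi> (fst s') - \<phi> (fst s)))
          = level_generator N lam \<mu> \<xi> \<phi> (fst s)"
        using sum_catastrophe_rates[OF assms(2), of "fst s" N "snd s"] assms(1) by auto
    qed
    finally show "((\<lambda>t. \<Sum>k\<le>N. f t k * \<phi> k) has_real_derivative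
        (\<Sum>k\<le>N. f t k * level_generator N lam \<mu> \<xi> \<phi> k)) (at t)"
      by (simp only: f)
  qed
qed

subsection \<open>The limiting generating function\<close>

text \<open>The product rule leaves two terms with a factor \<open>r\<close>, and
  \<open>(lam + \<mu>) * r * y = w - u\<close> turns each into a difference of neighbouring
  products. With \<open>Suc m = N + k\<close> and \<open>n = N - k\<close> the coefficients are the
  death and birth rates.\<close>

lemma pderiv_power_mult_power:
  fixes lam \<mu> r :: real
  defines "u \<equiv> [:1, - (\<mu> * r):]" and "w \<equiv> [:1, lam * r:]"
  shows "smult (lam + \<mu>) (pCons 0 (pderiv (u ^ Suc m * w ^ n)))
    = smult (\<mu> * real (Suc m)) (u ^ Suc m * w ^ n - u ^ m * w ^ Suc n)
      + smult (lam * real n) (u ^ Suc m * w ^ n - u ^ Suc (Suc m) * w ^ (n - 1))"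
proof -
  have "pderiv u = [:- (\<mu> * r):]" "pderiv w = [:lam * r:]"
    by (simp_all add: u_def w_def pderiv_pCons)
  then have d: "pderiv (u ^ Suc m * w ^ n) = smult (- (\<mu> * r) * real (Suc m)) (u ^ m * w ^ n)
      + smult (lam * r * real n) (u ^ Suc m * w ^ (n - 1))"
    by (cases n) (simp_all add: pderiv_mult pderiv_power_Suc mult_ac del: power_Suc of_nat_Suc)
  show ?thesis
  proof (rule poly_eq_poly_eq_iff[THEN iffD1], rule ext)
    fix x
    have "(lam + \<mu>) * (r * x) = poly w x - poly u x"
      by (simp add: u_def w_def algebra_simps)
    then have x: "(lam + \<mu>) * (x * (r * y)) = (poly w x - poly u x) * y" for y
      by (simp add: mult_ac)
    have "poly (smult (lam + \<mu>) (pCons 0 (pderiv (u ^ Suc m * w ^ n)))) x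
      = (lam + \<mu>) * (x * (r * (- \<mu> * real (Suc m) * (poly u x ^ m * poly w x ^ n)
          + lam * real n * (poly u x ^ Suc m * poly w x ^ (n - 1)))))"
      unfolding d by (simp add: algebra_simps)
    then show "poly (smult (lam + \<mu>) (pCons 0 (pderiv (u ^ Suc m * w ^ n)))) x
      = poly (smult (\<mu> * real (Suc m)) (u ^ Suc m * w ^ n - u ^ m * w ^ Suc n)
        + smult (lam * real n) (u ^ Suc m * w ^ n - u ^ Suc (Suc m) * w ^ (n - 1))) x"
      unfolding x by (cases n) (simp_all add: algebra_simps)
  qed
qed

text \<open>Integration by parts applied to \<open>b k\<close>. For \<open>k = 0\<close> the lower
  neighbour has exponents \<open>N - 1\<close> and \<open>N + 1\<close> and is none of the
  \<open>b j\<close>, while the generator has no death term; the difference yields the term with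
  \<open>\<kappa>\<close>.\<close>

lemma level_generator_poly_moment:
  fixes r :: real
  assumes "N \<ge> 1" "k \<le> N" "lam > 0" "\<mu> > 0" "\<xi> > 0"
  defines "a \<equiv> \<xi> / (lam + \<mu>)"
    and "b \<equiv> \<lambda>k. [:1, - (\<mu> * r):] ^ (N + k) * [:1, lam * r:] ^ (N - k)"
  defines "\<beta> \<equiv> \<lambda>k. poly_moment a (b k)"
    and "\<kappa> \<equiv> poly_moment (a + 1) ([:1, - (\<mu> * r):] ^ (N - 1) * [:1, lam * r:] ^ N)"
  shows "poly (b k) 1 + (if k = 0 then real N * \<mu> * r * \<kappa> else 0)
    = a * \<beta> 0 - level_generator N lam \<mu> \<xi> \<beta> k / (lam + \<mu>)"
proof -
  let ?u = "[:1, - (\<mu> * r):]" and ?w = "[:1, lam * r:]"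
  have A: "lam + \<mu> > 0" and a: "a > 0" and \<xi>: "\<xi> = (lam + \<mu>) * a"
    using assms by (auto simp: a_def)
  obtain m where m: "N + k = Suc m"
    using assms(1) by (cases "N + k") auto
  \<comment> \<open>The moment of the lower neighbour: \<open>\<beta> (k - 1)\<close> for
    \<open>k > 0\<close>, and \<open>\<beta> 0 + (lam + \<mu>) * r * \<kappa>\<close> for
    \<open>k = 0\<close>.\<close>
  define \<gamma> where "\<gamma> = poly_moment a (?u ^ m * ?w ^ Suc (N - k))"
  have "(lam + \<mu>) * (poly (b k) 1 - a * \<beta> k)
      = poly_moment a (smult (lam + \<mu>) (pCons 0 (pderiv (?u ^ Suc m * ?w ^ (N - k)))))"
    using poly_moment_pderiv[OF a, of "b k"] by (simp only: poly_moment_smult b_def \<beta>_def m)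
  also have "\<dots> = \<mu> * real (N + k) * (\<beta> k - \<gamma>) + lam * (real N - real k) * (\<beta> k - \<beta> (k + 1))"
    using assms(2) unfolding pderiv_power_mult_power
    by (simp only: poly_moment_add poly_moment_smult poly_moment_diff \<beta>_def b_def \<gamma>_def m
        of_nat_diff[OF assms(2)] add_Suc_right Suc_eq_plus1[symmetric] diff_Suc_eq_diff_pred
        diff_commute[of N 1 k] diff_diff_left)
  finally have main: "(lam + \<mu>) * (poly (b k) 1 - a * \<beta> k)
      = \<mu> * real (N + k) * (\<beta> k - \<gamma>) + lam * (real N - real k) * (\<beta> k - \<beta> (k + 1))" .
  show ?thesis
  proof (cases "k = 0")
    case True
    with m have m': "m = N - 1" by simp
    have "?u ^ m * ?w ^ Suc N = ?u ^ Suc m * ?w ^ N + smult ((lam + \<mu>) * r) (pCons 0 (?u ^ m * ?w ^ N))"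
      by (rule poly_eq_poly_eq_iff[THEN iffD1], rule ext) (simp add: algebra_simps)
    moreover have "\<gamma> = poly_moment a (?u ^ m * ?w ^ Suc N)"
      by (simp only: \<gamma>_def True diff_zero)
    moreover have "\<beta> 0 = poly_moment a (?u ^ Suc m * ?w ^ N)"
      by (simp only: \<beta>_def b_def diff_zero m[unfolded True])
    ultimately have "\<gamma> = \<beta> 0 + (lam + \<mu>) * r * \<kappa>"
      by (simp only: poly_moment_add poly_moment_smult poly_moment_pCons_0 \<kappa>_def m')
    then show ?thesis
      using main A True by (simp add: level_generator_def field_simps)
  next
    case False
    then have "\<gamma> = \<beta> (k - 1)"
      using m assms(2) by (simp add: \<gamma>_def \<beta>_def b_def Suc_diff_le[symmetric] flip: power_Suc)
    then show ?thesis
      using main A False by (simp add: level_generator_def \<xi> field_simps)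
  qed
qed

text \<open>The previous identity is averaged over \<open>f t\<close>, and the mean of the generator
  tends to \<open>0\<close>. The parameter \<open>r\<close> stays free because two values are
  needed: \<open>1 / \<mu>\<close> for the probability of level \<open>0\<close>, then the one
  belonging to \<open>z\<close>.\<close>

lemma level_pgf_limit:
  fixes r :: real and f :: "real \<Rightarrow> nat \<Rightarrow> real"
  assumes "N \<ge> 1" "lam > 0" "\<mu> > 0" "\<xi> > 0"
    and f_sum: "\<And>t. t > 0 \<Longrightarrow> (\<Sum>k\<le>N. f t k) = 1"
    and f_der: "\<And>\<phi> t. t > 0 \<Longrightarrow> ((\<lambda>t. \<Sum>k\<le>N. f t k * \<phi> k) has_real_derivative
        (\<Sum>k\<le>N. f t k * level_generator N lam \<mu> \<xi> \<phi> k)) (at t)"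
  defines "a \<equiv> \<xi> / (lam + \<mu>)"
  defines "\<kappa> \<equiv> poly_moment (a + 1) ([:1, - (\<mu> * r):] ^ (N - 1) * [:1, lam * r:] ^ N)"
  shows "((\<lambda>t. (\<Sum>k\<le>N. f t k * ((1 - \<mu> * r) ^ (N + k) * (1 + lam * r) ^ (N - k)))
        + f t 0 * (real N * \<mu> * r * \<kappa>))
    \<longlongrightarrow> a * poly_moment a ([:1, - (\<mu> * r):] ^ N * [:1, lam * r:] ^ N)) at_top"
proof -
  define b where "b k = [:1, - (\<mu> * r):] ^ (N + k) * [:1, lam * r:] ^ (N - k)" for k
  define \<beta> where "\<beta> k = poly_moment a (b k)" for k
  have step: "poly (b k) 1 + (if k = 0 then real N * \<mu> * r * \<kappa> else 0)
      = a * \<beta> 0 - level_generator N lam \<mu> \<xi> \<beta> k / (lam + \<mu>)" if "k \<le> N" for k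
    using level_generator_poly_moment[OF assms(1) that assms(2-4), of r]
    by (simp only: b_def \<beta>_def[abs_def] a_def \<kappa>_def)
  let ?G = "\<lambda>t. \<Sum>k\<le>N. f t k * level_generator N lam \<mu> \<xi> \<beta> k"
  have "(?G \<longlongrightarrow> 0) at_top"
    by (rule level_generator_mean_tendsto_0[OF assms(2-4) f_der])
  then have "((\<lambda>t. a * \<beta> 0 - ?G t / (lam + \<mu>)) \<longlongrightarrow> a * \<beta> 0 - 0 / (lam + \<mu>)) at_top"
    using assms by (intro tendsto_intros) auto
  moreover have "\<forall>\<^sub>F t in at_top. a * \<beta> 0 - ?G t / (lam + \<mu>)
      = (\<Sum>k\<le>N. f t k * ((1 - \<mu> * r) ^ (N + k) * (1 + lam * r) ^ (N - k)))
        + f t 0 * (real N * \<mu> * r * \<kappa>)"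
    using eventually_gt_at_top[of 0]
  proof eventually_elim
    case (elim t)
    have "(\<Sum>k\<le>N. f t k * ((1 - \<mu> * r) ^ (N + k) * (1 + lam * r) ^ (N - k)))
        + f t 0 * (real N * \<mu> * r * \<kappa>)
      = (\<Sum>k\<le>N. f t k * (poly (b k) 1 + (if k = 0 then real N * \<mu> * r * \<kappa> else 0)))"
      by (simp add: b_def distrib_left sum.distrib if_distrib[of "\<lambda>x. _ * x"] cong: if_cong)
    also have "\<dots> = (\<Sum>k\<le>N. f t k * (a * \<beta> 0 - level_generator N lam \<mu> \<xi> \<beta> k / (lam + \<mu>)))"
      by (intro sum.cong refl arg_cong2[where f = "(*)"] step) simp
    also have "\<dots> = a * \<beta> 0 * (\<Sum>k\<le>N. f t k) - ?G t / (lam + \<mu>)"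
      by (simp add: algebra_simps sum_subtractf sum_distrib_left sum_divide_distrib)
    finally show ?case
      using f_sum[OF elim] by simp
  qed
  ultimately show ?thesis
    by (auto simp: \<beta>_def b_def elim: Lim_transform_eventually)
qed

theorem proposition4p1:
  fixes N d l0 :: nat and lam \<mu> \<xi> z :: real
    and c :: "nat \<Rightarrow> nat \<Rightarrow> real"
    and M :: "'w measure" and X :: "real \<Rightarrow> 'w \<Rightarrow> nat \<times> nat"
  assumes "N \<ge> 1" "d \<ge> 1" "lam > 0" "\<mu> > 0" "\<xi> > 0"
    and "stochastic_on {1..d} c" "irreducible_on {1..d} c"
    and "l0 \<in> {1..d}"
    and "ct_markov_chain M X ({0..N} \<times> {1..d}) (catastrophe_rates N lam \<mu> \<xi> c)"
    and "AE \<omega> in M. X 0 \<omega> = (0, l0)"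
    and "0 < z" "z \<le> 1"
  shows "((\<lambda>t. prob_space.expectation M (\<lambda>\<omega>. z ^ fst (X t \<omega>))) \<longlongrightarrow>
      - (real N * \<mu> * (1 - z) * (lam * z + \<mu>) ^ N / ((lam + \<mu>) ^ (2 * N) * z ^ N))
        * g_ratio lam \<mu> \<xi> N
        * (\<Sum>j = 0..N - 1. real (N - 1 choose j)
            * ((lam + \<mu>) * z) ^ (N - j - 1) * (\<mu> * (1 - z)) ^ j
            * (Gamma (real j + 1) * Gamma (\<xi> / (lam + \<mu>) + 1)
                / Gamma (real j + \<xi> / (lam + \<mu>) + 2))
            * hyp2F1 (\<xi> / (lam + \<mu>) + 1) (- real N) (\<xi> / (lam + \<mu>) + real j + 2)
                (- (lam * (1 - z) / (lam * z + \<mu>))))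
      + (lam * z + \<mu>) ^ N / ((lam + \<mu>) ^ (2 * N) * z ^ N)
        * (\<Sum>j = 0..N. real (N choose j)
            * ((lam + \<mu>) * z) ^ (N - j) * (\<mu> * (1 - z)) ^ j
            * (Gamma (real j + 1) * Gamma (\<xi> / (lam + \<mu>) + 1)
                / Gamma (real j + \<xi> / (lam + \<mu>) + 1))
            * hyp2F1 (\<xi> / (lam + \<mu>)) (- real N) (\<xi> / (lam + \<mu>) + real j + 1)
                (- (lam * (1 - z) / (lam * z + \<mu>))))) at_top"
proof -
  obtain f :: "real \<Rightarrow> nat \<Rightarrow> real" where
    f_sum: "\<And>t. t > 0 \<Longrightarrow> (\<Sum>k\<le>N. f t k) = 1" and
    f_mean: "\<And>t \<phi>. t > 0 \<Longrightarrow> (\<integral>\<omega>. \<phi> (fst (X t \<omega>)) \<partial>M) = (\<Sum>k\<le>N. f t k * \<phi> k)" and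
    f_der: "\<And>t \<phi>. t > 0 \<Longrightarrow> ((\<lambda>t. \<Sum>k\<le>N. f t k * \<phi> k) has_real_derivative
        (\<Sum>k\<le>N. f t k * level_generator N lam \<mu> \<xi> \<phi> k)) (at t)"
    using catastrophe_level_distribution[OF assms(1,6,8-10)] by blast
  note limit = level_pgf_limit[OF assms(1,3-5) f_sum f_der]
  define a where "a = \<xi> / (lam + \<mu>)"
  define \<kappa> where "\<kappa> r = poly_moment (a + 1) ([:1, - (\<mu> * r):] ^ (N - 1) * [:1, lam * r:] ^ N)" for r
  define \<beta> where "\<beta> r = poly_moment a ([:1, - (\<mu> * r):] ^ N * [:1, lam * r:] ^ N)" for r
  define v where "v = lam * z + \<mu>"
  define r where "r = (1 - z) / v"
  define A where "A = lam + \<mu>"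
  have A: "A > 0" and a: "a > 0" and v: "v > 0"
    using assms by (auto simp: A_def a_def v_def intro!: add_pos_pos)
  have Gamma_a: "Gamma (a + 1) = a * Gamma a"
    by (rule Gamma_plus1_pos[OF a])

  text \<open>At \<open>r = 1 / \<mu>\<close>, that is \<open>z = 0\<close>, the generating function term vanishes, which leaves
    the limiting probability of level \<open>0\<close>.\<close>
  have f0: "((\<lambda>t. f t 0) \<longlongrightarrow> g_ratio lam \<mu> \<xi> N) at_top"
  proof -
    let ?h0 = "hyp2F1 a (- real N) (a + real N + 1) (- (lam / \<mu>))"
    let ?h1 = "hyp2F1 (a + 1) (- real N) (a + real N + 1) (- (lam / \<mu>))"
    \<comment> \<open>The Gamma factor common to both moments at \<open>r = 1 / \<mu>\<close>, as N
      \<Gamma>(N) = \<Gamma>(N + 1) and a \<Gamma>(a) = \<Gamma>(a + 1). It cancels and leaves the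
      quotient \<open>g_ratio\<close>.\<close>
    define C where "C = real N * Gamma (real N) * Gamma (a + 1) / Gamma (a + real N + 1)"
    have N: "real (N - 1) + 1 = real N"
      using assms(1) by simp
    have C: "C > 0"
      using assms(1) a by (auto simp: C_def intro!: divide_pos_pos mult_pos_pos Gamma_real_pos)
    have h1: "?h1 > 0"
      using a assms by (intro hyp2F1_neg_nat_pos) auto
    have \<kappa>: "real N * \<kappa> (1 / \<mu>) = C * ?h1"
      using poly_moment_Euler[of "a + 1" "N - 1" "- (lam / \<mu>)" N] a assms N
      by (simp add: \<kappa>_def C_def add_ac)
    have \<beta>: "a * \<beta> (1 / \<mu>) = C * ?h0"
      using poly_moment_Euler[OF a, of N "- (lam / \<mu>)" N] assms(1,4) Gamma_a
        Gamma_plus1_pos[of "real N"]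
      by (simp add: \<beta>_def C_def add_ac)
    have "((\<lambda>t. f t 0 * (C * ?h1)) \<longlongrightarrow> C * ?h0) at_top"
      using limit[of "1 / \<mu>"] assms(1,4)
      by (simp add: \<kappa>[symmetric] \<beta>[symmetric])
        (simp add: \<kappa>_def \<beta>_def a_def power_0_left)
    then have "((\<lambda>t. f t 0 * (C * ?h1) / (C * ?h1)) \<longlongrightarrow> C * ?h0 / (C * ?h1)) at_top"
      by (rule tendsto_divide[OF _ tendsto_const]) (use C h1 in simp)
    then show ?thesis
      using C h1 by (simp add: g_ratio_def a_def)
  qed

  have r: "1 - \<mu> * r = A / v * z" "1 + lam * r = A / v"
    using v by (simp_all add: r_def A_def field_simps) (simp_all add: v_def algebra_simps)
  \<comment> \<open>The factors at \<open>y = 1\<close> are \<open>A / v * z\<close> and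
    \<open>A / v\<close>, and their exponents add up to \<open>2 * N\<close>, so only
    \<open>z ^ k\<close> depends on the level.\<close>
  have summand: "(1 - \<mu> * r) ^ (N + k) * (1 + lam * r) ^ (N - k) = A ^ (2 * N) * z ^ N / v ^ (2 * N) * z ^ k"
    if "k \<le> N" for k
  proof -
    have "(1 - \<mu> * r) ^ (N + k) * (1 + lam * r) ^ (N - k) = (A / v) ^ (N + k + (N - k)) * z ^ (N + k)"
      by (simp only: r power_mult_distrib power_add mult_ac)
    also have "N + k + (N - k) = 2 * N"
      using that by simp
    finally show ?thesis
      by (simp add: power_divide power_add)
  qed
  have "((\<lambda>t. (\<Sum>k\<le>N. f t k * ((1 - \<mu> * r) ^ (N + k) * (1 + lam * r) ^ (N - k)))
        + f t 0 * (real N * \<mu> * r * \<kappa> r) - f t 0 * (real N * \<mu> * r * \<kappa> r))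
      \<longlongrightarrow> a * \<beta> r - g_ratio lam \<mu> \<xi> N * (real N * \<mu> * r * \<kappa> r)) at_top"
    using limit[of r] unfolding \<beta>_def \<kappa>_def a_def by (intro tendsto_intros f0) auto
  then have "((\<lambda>t. v ^ (2 * N) / (A ^ (2 * N) * z ^ N) *
        (\<Sum>k\<le>N. f t k * ((1 - \<mu> * r) ^ (N + k) * (1 + lam * r) ^ (N - k))))
      \<longlongrightarrow> v ^ (2 * N) / (A ^ (2 * N) * z ^ N)
        * (a * \<beta> r - g_ratio lam \<mu> \<xi> N * (real N * \<mu> * r * \<kappa> r))) at_top"
    by (intro tendsto_mult_left) simp
  moreover have "\<forall>\<^sub>F t in at_top. v ^ (2 * N) / (A ^ (2 * N) * z ^ N) *
        (\<Sum>k\<le>N. f t k * ((1 - \<mu> * r) ^ (N + k) * (1 + lam * r) ^ (N - k)))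
      = (\<integral>\<omega>. z ^ fst (X t \<omega>) \<partial>M)"
    using eventually_gt_at_top[of 0]
  proof eventually_elim
    case (elim t)
    have "v ^ (2 * N) / (A ^ (2 * N) * z ^ N) *
        (\<Sum>k\<le>N. f t k * ((1 - \<mu> * r) ^ (N + k) * (1 + lam * r) ^ (N - k))) = (\<Sum>k\<le>N. f t k * z ^ k)"
      unfolding sum_distrib_left
      by (intro sum.cong refl) (use A v assms in \<open>simp add: summand\<close>)
    then show ?case
      using f_mean[OF elim, of "\<lambda>k. z ^ k"] by simp
  qed
  ultimately have "((\<lambda>t. \<integral>\<omega>. z ^ fst (X t \<omega>) \<partial>M) \<longlongrightarrow> v ^ (2 * N) / (A ^ (2 * N) * z ^ N)
        * (a * \<beta> r - g_ratio lam \<mu> \<xi> N * (real N * \<mu> * r * \<kappa> r))) at_top"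
    by (rule Lim_transform_eventually)
  \<comment> \<open>The denominator of \<open>r\<close> consumes one power of \<open>v\<close>;
    hence \<open>\<kappa> r\<close> is paired with \<open>v ^ (N - 1)\<close> but
    \<open>\<beta> r\<close> with \<open>v ^ N\<close>, as the two binomial sums require.\<close>
  moreover have "v ^ (2 * N) / (A ^ (2 * N) * z ^ N)
        * (a * \<beta> r - g_ratio lam \<mu> \<xi> N * (real N * \<mu> * r * \<kappa> r))
      = - (real N * \<mu> * (1 - z) * v ^ N / (A ^ (2 * N) * z ^ N)) * g_ratio lam \<mu> \<xi> N * (v ^ (N - 1) * \<kappa> r)
        + v ^ N / (A ^ (2 * N) * z ^ N) * (a * (v ^ N * \<beta> r))"
  proof -
    have e1: "v ^ (2 * N) = v ^ N * v ^ N"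
      by (simp add: mult_2 power_add)
    have "v ^ N = v * v ^ (N - 1)"
      using assms(1) by (cases N) auto
    then have e2: "v ^ (2 * N) * r = v ^ N * v ^ (N - 1) * (1 - z)"
      using v by (simp add: e1 r_def)
    have "v ^ (2 * N) / (A ^ (2 * N) * z ^ N) * (a * \<beta> r - g_ratio lam \<mu> \<xi> N * (real N * \<mu> * r * \<kappa> r))
        = v ^ (2 * N) * (a * \<beta> r) / (A ^ (2 * N) * z ^ N)
          - g_ratio lam \<mu> \<xi> N * real N * \<mu> * \<kappa> r * (v ^ (2 * N) * r) / (A ^ (2 * N) * z ^ N)"
      by (simp add: right_diff_distrib diff_divide_distrib mult_ac)
    then show ?thesis
      unfolding e2 unfolding e1 by (simp add: mult_ac)
  qed
  moreover have "(\<Sum>j = 0..N - 1. real (N - 1 choose j)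
            * (A * z) ^ (N - j - 1) * (\<mu> * (1 - z)) ^ j
            * (Gamma (real j + 1) * Gamma (a + 1) / Gamma (real j + a + 2))
            * hyp2F1 (a + 1) (- real N) (a + real j + 2) (- (lam * (1 - z) / v)))
      = v ^ (N - 1) * \<kappa> r"
    using binomial_sum_poly_moment_Euler[of "a + 1" lam z \<mu> "N - 1" N] a v
    by (simp add: atLeast0AtMost v_def A_def r_def \<kappa>_def add_ac)
  \<comment> \<open>The factor \<open>a\<close> from the integration by parts turns
    \<open>Gamma a\<close> of Euler's integral into \<open>Gamma (a + 1)\<close>.\<close>
  moreover have "(\<Sum>j = 0..N. real (N choose j)
            * (A * z) ^ (N - j) * (\<mu> * (1 - z)) ^ j
            * (Gamma (real j + 1) * Gamma (a + 1) / Gamma (real j + a + 1))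
            * hyp2F1 a (- real N) (a + real j + 1) (- (lam * (1 - z) / v)))
      = a * (v ^ N * \<beta> r)"
    using arg_cong[OF binomial_sum_poly_moment_Euler[of a lam z \<mu> N N], of "(*) a"] a v Gamma_a
    by (simp add: atLeast0AtMost v_def A_def r_def \<beta>_def sum_distrib_left add_ac mult_ac)
  ultimately show ?thesis
    unfolding A_def v_def a_def by (simp only:)
qed

end
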